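(* Let $(X,\tau)$ and $(Y,\sigma)$ be topological spaces. For a function $f \colon (X,\tau) \rightarrow (Y,\sigma)$, the following conditions are equivalent: (1) $f$ is continuous. (2) $f$ is $\mathcal{AB}$-continuous and $f$ is either precontinuous or ic-continuous.
   Context: For a subset $A$ of a topological space $X$, $\mathrm{Int}\,A$ denotes the interior and $\overline{A}$ the closure of $A$ in $X$. $A$ is semi-open if $A \subseteq \overline{\mathrm{Int}\,A}$; semi-closed if its complement is semi-open; semi-regular if it is both semi-open and semi-closed. $A$ is an $\mathcal{AB}$-set if $A = U \cap V$ with $U$ open and $V$ semi-regular. $A$ is preopen (= locally dense) if $A \subseteq \mathrm{Int}\,\overline{A}$. $A$ is an ic-set (= interior-closed) if $\mathrm{Int}\,A$ is closed in the subspace $A$. A function $f \colon X \to Y$ is $\mathcal{AB}$-continuous (respectively precontinuous, ic-continuous) if for every open $V \subseteq Y$ the preimage $f^{-1}(V)$ is an $\mathcal{AB}$-set (respectively a preopen set, an ic-set) in $X$. *)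

theory Defs
  imports "HOL-Analysis.Abstract_Topology"
begin

definition semi_open_in :: "'a topology \<Rightarrow> 'a set \<Rightarrow> bool" where
  "semi_open_in X A \<longleftrightarrow> A \<subseteq> topspace X \<and> A \<subseteq> X closure_of (X interior_of A)"

definition semi_closed_in :: "'a topology \<Rightarrow> 'a set \<Rightarrow> bool" where
  "semi_closed_in X A \<longleftrightarrow> A \<subseteq> topspace X \<and> semi_open_in X (topspace X - A)"

definition semi_regular_in :: "'a topology \<Rightarrow> 'a set \<Rightarrow> bool" where
  "semi_regular_in X A \<longleftrightarrow> semi_open_in X A \<and> semi_closed_in X A"

definition AB_set_in :: "'a topology \<Rightarrow> 'a set \<Rightarrow> bool" where
  "AB_set_in X A \<longleftrightarrow> (\<exists>U V. openin X U \<and> semi_regular_in X V \<and> A = U \<inter> V)"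

definition preopen_in :: "'a topology \<Rightarrow> 'a set \<Rightarrow> bool" where
  "preopen_in X A \<longleftrightarrow> A \<subseteq> topspace X \<and> A \<subseteq> X interior_of (X closure_of A)"

definition ic_set_in :: "'a topology \<Rightarrow> 'a set \<Rightarrow> bool" where
  "ic_set_in X A \<longleftrightarrow> A \<subseteq> topspace X \<and> closedin (subtopology X A) (X interior_of A)"

text \<open>
  The following notions are meant for functions that map \<open>topspace X\<close> into \<open>topspace Y\<close>;
  unlike \<open>continuous_map\<close>, they do not include this requirement. Since functions are total
  on the underlying type, preimages are taken within \<open>topspace X\<close>.
\<close>

definition AB_continuous_map :: "'a topology \<Rightarrow> 'b topology \<Rightarrow> ('a \<Rightarrow> 'b) \<Rightarrow> bool" where
  "AB_continuous_map X Y f \<longleftrightarrow>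
     (\<forall>V. openin Y V \<longrightarrow> AB_set_in X {x \<in> topspace X. f x \<in> V})"

definition precontinuous_map :: "'a topology \<Rightarrow> 'b topology \<Rightarrow> ('a \<Rightarrow> 'b) \<Rightarrow> bool" where
  "precontinuous_map X Y f \<longleftrightarrow>
     (\<forall>V. openin Y V \<longrightarrow> preopen_in X {x \<in> topspace X. f x \<in> V})"

definition ic_continuous_map :: "'a topology \<Rightarrow> 'b topology \<Rightarrow> ('a \<Rightarrow> 'b) \<Rightarrow> bool" where
  "ic_continuous_map X Y f \<longleftrightarrow>
     (\<forall>V. openin Y V \<longrightarrow> ic_set_in X {x \<in> topspace X. f x \<in> V})"

end

theory Submission
  imports Defs
begin

text \<open>
  For an \<open>\<A>\<B>\<close>-set \<open>A = U \<inter> V\<close>, preopenness gives \<open>A = U \<inter> Int (cl V)\<close>, because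
  \<open>Int (cl V) \<subseteq> V\<close> for semi-closed \<open>V\<close>. Semi-openness of \<open>V\<close> makes \<open>A\<close> itself semi-open,
  so \<open>Int A\<close> is dense in \<open>A\<close> and equals \<open>A\<close> as soon as it is closed in \<open>A\<close>. Hence
  each of the two extra conditions turns an \<open>\<A>\<B>\<close>-set into an open set.
\<close>

text \<open>Complementation exchanges interior and closure, which turns semi-openness of the
  complement into a condition on \<open>A\<close> itself.\<close>

lemma semi_closed_in_iff_interior_closure_subset:
  "semi_closed_in X A \<longleftrightarrow> A \<subseteq> topspace X \<and> X interior_of (X closure_of A) \<subseteq> A"
proof -
  have "X closure_of (X interior_of (topspace X - A)) =
      topspace X - X interior_of (X closure_of A)"
    by (simp add: interior_of_complement closure_of_complement)
  moreover have "X interior_of (X closure_of A) \<subseteq> topspace X"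
    by (rule interior_of_subset_topspace)
  ultimately show ?thesis
    unfolding semi_closed_in_def semi_open_in_def by auto
qed

text \<open>For open \<open>U\<close>, a point of \<open>U\<close> in the closure of a set
  \<open>S\<close> lies in the closure of \<open>U \<inter> S\<close>; apply this with
  \<open>S\<close> the interior of \<open>V\<close>.\<close>

lemma semi_open_in_Int_openin:
  assumes "openin X U" "semi_open_in X V"
  shows "semi_open_in X (U \<inter> V)"
proof -
  have "U \<inter> V \<subseteq> U \<inter> X closure_of (X interior_of V)"
    using assms(2) by (auto simp: semi_open_in_def)
  also have "\<dots> \<subseteq> X closure_of (U \<inter> X interior_of V)"
    using assms(1) by (rule openin_Int_closure_of_subset)
  also have "U \<inter> X interior_of V = X interior_of (U \<inter> V)"
    using assms(1) by (simp add: interior_of_Int interior_of_openin)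
  finally show ?thesis
    using assms(2) by (auto simp: semi_open_in_def)
qed

lemma semi_open_ic_set_imp_openin:
  assumes "semi_open_in X A" "ic_set_in X A"
  shows "openin X A"
proof -
  obtain C where C: "closedin X C" "X interior_of A = C \<inter> A"
    using assms(2) by (auto simp: ic_set_in_def closedin_subtopology)
  then have "X closure_of (X interior_of A) \<subseteq> C"
    by (simp add: closure_of_minimal)
  \<comment> \<open>Semi-openness now puts \<open>A\<close> inside \<open>C\<close>, so
    \<open>C \<inter> A\<close>, which is the interior of \<open>A\<close>, is all of
    \<open>A\<close>.\<close>
  then have "A \<subseteq> X interior_of A"
    using assms(1) C(2) by (auto simp: semi_open_in_def)
  then show ?thesis
    by (simp add: interior_of_subset subset_antisym flip: interior_of_eq)
qed

lemma AB_preopen_imp_openin: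
  assumes "AB_set_in X A" "preopen_in X A"
  shows "openin X A"
proof -
  obtain U V where UV: "openin X U" "semi_closed_in X V" "A = U \<inter> V"
    using assms(1) by (auto simp: AB_set_in_def semi_regular_in_def)
  \<comment> \<open>Preopenness of \<open>A\<close> passes to the larger set \<open>V\<close> by
    monotonicity.\<close>
  have "A \<subseteq> X interior_of (X closure_of V)"
    using assms(2) interior_of_mono[OF closure_of_mono, of A V X] UV(3)
    by (auto simp: preopen_in_def)
  then have "A = U \<inter> X interior_of (X closure_of V)"
    using UV by (auto simp: semi_closed_in_iff_interior_closure_subset)
  moreover have "openin X (U \<inter> X interior_of (X closure_of V))"
    using UV(1) by (simp add: openin_Int)
  ultimately show ?thesis
    by simp
qed

lemma AB_ic_imp_openin:
  assumes "AB_set_in X A" "ic_set_in X A"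
  shows "openin X A"
proof -
  have "semi_open_in X A"
    using assms(1) by (auto simp: AB_set_in_def semi_regular_in_def semi_open_in_Int_openin)
  then show ?thesis
    using assms(2) by (rule semi_open_ic_set_imp_openin)
qed

text \<open>The whole space serves as the semi-regular factor.\<close>

lemma openin_imp_AB_set_in:
  assumes "openin X A"
  shows "AB_set_in X A"
proof -
  have "semi_regular_in X (topspace X)"
    by (simp add: semi_regular_in_def semi_closed_in_def semi_open_in_def)
  moreover have "A = A \<inter> topspace X"
    using openin_subset[OF assms] by auto
  ultimately show ?thesis
    using assms unfolding AB_set_in_def by blast
qed

lemma openin_imp_preopen_in:
  assumes "openin X A"
  shows "preopen_in X A"
  using assms
  by (simp add: preopen_in_def openin_subset interior_of_maximal closure_of_subset)

theorem theorem4p4: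
  fixes X :: "'a topology" and Y :: "'b topology" and f :: "'a \<Rightarrow> 'b"
  assumes "f \<in> topspace X \<rightarrow> topspace Y"
  shows "continuous_map X Y f \<longleftrightarrow>
    AB_continuous_map X Y f \<and> (precontinuous_map X Y f \<or> ic_continuous_map X Y f)"
proof
  assume "continuous_map X Y f"
  then show "AB_continuous_map X Y f \<and> (precontinuous_map X Y f \<or> ic_continuous_map X Y f)"
    \<comment> \<open>The disjunction is settled through precontinuity, since open sets are
      preopen.\<close>
    by (simp add: continuous_map_def AB_continuous_map_def precontinuous_map_def
        openin_imp_AB_set_in openin_imp_preopen_in)
next
  assume "AB_continuous_map X Y f \<and> (precontinuous_map X Y f \<or> ic_continuous_map X Y f)"
  then show "continuous_map X Y f"
    using assms
    by (auto simp: continuous_map_def AB_continuous_map_def precontinuous_map_def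
        ic_continuous_map_def intro: AB_preopen_imp_openin AB_ic_imp_openin)
qed

end
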